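(* Let $c$ be a circuit, $st_0$ an initial state, and $FD_c$ the fall-decoupled marked graph of $c$. Let $t$ be a trace with $FD_c\vdash t\Downarrow m$ for some marking $m$, let $l$ be a latch (transparent or opaque in $t$) and $v$ a value with $\langle c,st_0\rangle\vdash t\downarrow l\mapsto v$. Then $v=\mathrm{sync}(c,st_0,i)(l)$, where $i=1+\mathrm{num}(l+,t)$ if $l$ is odd and $i=\mathrm{num}(l+,t)$ if $l$ is even.
   Context: A value is either $\mathrm{Num}(n)$ with $n\in\mathbb N$ or the undefined value $X$. A circuit $c$ consists of: a set of even latches and a set of odd latches (the latches of $c$ are their disjoint union); a finite list of pairs $(E,O)$ with $E$ even, $O$ odd, and a finite list of pairs $(O,E)$ with $O$ odd, $E$ even, where a pair $(l,l')$ in either list means $l$ is a left neighbor of $l'$ (and $l'$ a right neighbor of $l$); and for each latch $l$ a next-state function mapping an assignment of values to the left neighbors of $l$ to a value. A state is a function from latches to values; $\mathrm{next}_c(st,l)$ denotes the next-state function of $l$ applied to the restriction of $st$ to the left neighbors of $l$. Synchronous execution: $\mathrm{sync}(c,st_0,n)(l)$ equals $st_0(l)$ if $n=0$ and $l$ even; $X$ if $n=0$ and $l$ odd; $\mathrm{next}_c(\mathrm{sync}(c,st_0,n),l)$ if $n>0$ and $l$ even; $\mathrm{next}_c(\mathrm{sync}(c,st_0,n-1),l)$ if $n>0$ and $l$ odd. Events are $l+$ (rise of the clock of latch $l$) and $l-$ (fall). A trace is a finite sequence of events; $\varepsilon$ is the empty trace and $t\triangleright e$ is $t$ extended by event $e$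 as its most recent event. $\mathrm{num}(e,t)$ is the number of occurrences of $e$ in $t$. Transparency: $\mathrm{transp}(\varepsilon,l)=\mathrm{Transparent}$ if $l$ odd, $\mathrm{Opaque}$ if $l$ even; $\mathrm{transp}(t\triangleright l+,l)=\mathrm{Transparent}$; $\mathrm{transp}(t\triangleright l-,l)=\mathrm{Opaque}$; $\mathrm{transp}(t\triangleright e,l)=\mathrm{transp}(t,l)$ for other events $e$. Asynchronous execution: $\langle c,st_0\rangle\vdash t\downarrow l\mapsto v$ is the smallest relation on (trace, latch, value) closed under: (1) if $\mathrm{transp}(t,l)=\mathrm{Transparent}$ and $st$ is a state such that $\langle c,st_0\rangle\vdash t\downarrow l'\mapsto st(l')$ for every left neighbor $l'$ of $l$, then $\langle c,st_0\rangle\vdash t\downarrow l\mapsto \mathrm{next}_c(st,l)$; (2) for every even $l$, $\langle c,st_0\rangle\vdash \varepsilon\downarrow l\mapsto st_0(l)$; (3) if $\mathrm{transp}(t'\triangleright e,l)=\mathrm{Opaque}$, $e\neq l-$, and $\langle c,st_0\rangle\vdash t'\downarrow l\mapsto v$ with $\mathrm{transp}(t',l)=\mathrm{Opaque}$, then $\langle c,st_0\rangle\vdash t'\triangleright e\downarrow l\mapsto v$; (4) if $st$ is a state with $\langle c,st_0\rangle\vdash t'\downarrow l'\mapsto st(l')$ for every left neighbor $l'$ of $l$, then $\langle c,st_0\rangle\vdash t'\triangleright l-\downarrow l\mapsto \mathrm{next}_c(st,l)$. A marked graph over the set of events consists of a set of places, each with a unique input event and a unique output event, and an initial marking $m_0$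 (places $\to\mathbb N$). An event $e$ is enabled in a marking $m$ if $m(p)>0$ for every place $p$ with output event $e$; firing $e$ yields $m'$ with $m'(p)=m(p)-1$ if $p$'s output event is $e$, $m(p)+1$ if $p$'s input event is $e$, $m(p)$ otherwise. $M\vdash t\Downarrow m$ is defined inductively: $M\vdash\varepsilon\Downarrow m_0$; if $M\vdash t'\Downarrow m'$ and $e$ is enabled in $m'$, then $M\vdash t'\triangleright e\Downarrow m$ with $m$ the result of firing $e$ in $m'$. The fall-decoupled marked graph $FD_c$ has places (input $\to$ output) with initial markings: for each latch $l$, a place $l+\to l-$ with initial marking $1$ if $l$ odd, $0$ if $l$ even, and a place $l-\to l+$ with initial marking $1$ if $l$ even, $0$ if $l$ odd; for each neighbor pair $(l,l')$ ($l$ a left neighbor of $l'$), a place $l+\to l'+$ with initial marking $1$ if $l$ odd, $0$ if $l$ even, and a place $l'-\to l+$ with initial marking $0$. *)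

theory Defs
  imports Main "HOL-Library.FuncSet"
begin

datatype val = Num nat | X

type_synonym ('e, 'o) latch = "'e + 'o"

abbreviation Even :: "'e \<Rightarrow> ('e, 'o) latch" where "Even \<equiv> Inl"
abbreviation Odd :: "'o \<Rightarrow> ('e, 'o) latch" where "Odd \<equiv> Inr"

abbreviation is_even :: "('e, 'o) latch \<Rightarrow> bool" where "is_even l \<equiv> isl l"
abbreviation is_odd :: "('e, 'o) latch \<Rightarrow> bool" where "is_odd l \<equiv> \<not> isl l"

type_synonym ('e, 'o) state = "('e, 'o) latch \<Rightarrow> val"

text \<open>
  The latches are given by carrier sets rather than by the types themselves, so that
  either kind of latch may be absent. The next-state function of a latch is only ever
  applied to assignments restricted to its left neighbors, see \<open>next_val\<close>.
\<close>

record ('e, 'o) circuit =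
  even_latches :: "'e set"
  odd_latches :: "'o set"
  even_odd_nbrs :: "('e \<times> 'o) list"
  odd_even_nbrs :: "('o \<times> 'e) list"
  next_fun :: "('e, 'o) latch \<Rightarrow> (('e, 'o) latch \<Rightarrow> val) \<Rightarrow> val"

definition is_circuit :: "('e, 'o) circuit \<Rightarrow> bool" where
  "is_circuit c \<longleftrightarrow>
     set (even_odd_nbrs c) \<subseteq> even_latches c \<times> odd_latches c \<and>
     set (odd_even_nbrs c) \<subseteq> odd_latches c \<times> even_latches c"

definition latches :: "('e, 'o) circuit \<Rightarrow> ('e, 'o) latch set" where
  "latches c = even_latches c <+> odd_latches c"

definition left_nbrs :: "('e, 'o) circuit \<Rightarrow> ('e, 'o) latch \<Rightarrow> ('e, 'o) latch set" where
  "left_nbrs c l =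
     (case l of
        Even E \<Rightarrow> {Odd O' | O'. (O', E) \<in> set (odd_even_nbrs c)}
      | Odd O' \<Rightarrow> {Even E | E. (E, O') \<in> set (even_odd_nbrs c)})"

definition next_val :: "('e, 'o) circuit \<Rightarrow> ('e, 'o) state \<Rightarrow> ('e, 'o) latch \<Rightarrow> val" where
  "next_val c st l = next_fun c l (restrict st (left_nbrs c l))"

lemma next_val_cong [fundef_cong]:
  assumes "c = c'" "l = l'" "\<And>k. k \<in> left_nbrs c' l' \<Longrightarrow> st k = st' k"
  shows "next_val c st l = next_val c' st' l'"
  using assms unfolding next_val_def by (metis restrict_ext)

text \<open>
  In the third equation the index does not decrease, but the left neighbors of an even
  latch are odd.
\<close>

function sync :: "('e, 'o) circuit \<Rightarrow> ('e, 'o) state \<Rightarrow> nat \<Rightarrow> ('e, 'o) state" where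
  "sync c st0 0 (Even E) = st0 (Even E)"
| "sync c st0 0 (Odd O') = X"
| "sync c st0 (Suc n) (Even E) = next_val c (sync c st0 (Suc n)) (Even E)"
| "sync c st0 (Suc n) (Odd O') = next_val c (sync c st0 n) (Odd O')"
  by pat_completeness auto
termination
  by (relation "measures [\<lambda>(c, st0, n, l). n, \<lambda>(c, st0, n, l). if is_even l then 1 else 0]")
     (auto simp: left_nbrs_def)

datatype ('e, 'o) event = Rise "('e, 'o) latch" | Fall "('e, 'o) latch"

text \<open>
  The head of the list is the most recent event: the extension of \<open>t\<close> by \<open>e\<close> is \<open>e # t\<close>.
\<close>

type_synonym ('e, 'o) trace = "('e, 'o) event list"

abbreviation num :: "('e, 'o) event \<Rightarrow> ('e, 'o) trace \<Rightarrow> nat" where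
  "num e t \<equiv> count_list t e"

datatype transparency = Transparent | Opaque

fun transp :: "('e, 'o) trace \<Rightarrow> ('e, 'o) latch \<Rightarrow> transparency" where
  "transp [] l = (if is_odd l then Transparent else Opaque)"
| "transp (e # t) l =
     (if e = Rise l then Transparent else if e = Fall l then Opaque else transp t l)"

inductive async ::
  "('e, 'o) circuit \<Rightarrow> ('e, 'o) state \<Rightarrow> ('e, 'o) trace \<Rightarrow> ('e, 'o) latch \<Rightarrow> val \<Rightarrow> bool"
  for c :: "('e, 'o) circuit" and st0 :: "('e, 'o) state" where
  async_transparent:
    "\<lbrakk>l \<in> latches c; transp t l = Transparent;
      \<forall>l'\<in>left_nbrs c l. async c st0 t l' (st l')\<rbrakk>
     \<Longrightarrow> async c st0 t l (next_val c st l)"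
| async_init:
    "\<lbrakk>l \<in> latches c; is_even l\<rbrakk> \<Longrightarrow> async c st0 [] l (st0 l)"
| async_opaque:
    "\<lbrakk>transp (e # t) l = Opaque; e \<noteq> Fall l; async c st0 t l v; transp t l = Opaque\<rbrakk>
     \<Longrightarrow> async c st0 (e # t) l v"
| async_fall:
    "\<lbrakk>l \<in> latches c; \<forall>l'\<in>left_nbrs c l. async c st0 t l' (st l')\<rbrakk>
     \<Longrightarrow> async c st0 (Fall l # t) l (next_val c st l)"

record ('p, 'ev) marked_graph =
  mg_events :: "'ev set"
  mg_places :: "'p set"
  mg_input :: "'p \<Rightarrow> 'ev"
  mg_output :: "'p \<Rightarrow> 'ev"
  mg_init :: "'p \<Rightarrow> nat"

definition is_marked_graph :: "('p, 'ev) marked_graph \<Rightarrow> bool" where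
  "is_marked_graph M \<longleftrightarrow>
     (\<forall>p\<in>mg_places M. mg_input M p \<in> mg_events M \<and> mg_output M p \<in> mg_events M)"

definition enabled :: "('p, 'ev) marked_graph \<Rightarrow> 'ev \<Rightarrow> ('p \<Rightarrow> nat) \<Rightarrow> bool" where
  "enabled M e m \<longleftrightarrow>
     e \<in> mg_events M \<and> (\<forall>p\<in>mg_places M. mg_output M p = e \<longrightarrow> m p > 0)"

definition fire :: "('p, 'ev) marked_graph \<Rightarrow> 'ev \<Rightarrow> ('p \<Rightarrow> nat) \<Rightarrow> ('p \<Rightarrow> nat)" where
  "fire M e m =
     (\<lambda>p. if mg_output M p = e then m p - 1
          else if mg_input M p = e then m p + 1
          else m p)"

inductive mg_run :: "('p, 'ev) marked_graph \<Rightarrow> 'ev list \<Rightarrow> ('p \<Rightarrow> nat) \<Rightarrow> bool"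
  for M :: "('p, 'ev) marked_graph" where
  mg_run_empty: "mg_run M [] (mg_init M)"
| mg_run_step: "\<lbrakk>mg_run M t m; enabled M e m\<rbrakk> \<Longrightarrow> mg_run M (e # t) (fire M e m)"

text \<open>
  In the last two constructors the first argument is a left neighbor of the second.
\<close>

datatype ('e, 'o) fd_place =
    Rise_Fall "('e, 'o) latch"
  | Fall_Rise "('e, 'o) latch"
  | Left_Rise_Right_Rise "('e, 'o) latch" "('e, 'o) latch"
  | Right_Fall_Left_Rise "('e, 'o) latch" "('e, 'o) latch"

fun fd_input :: "('e, 'o) fd_place \<Rightarrow> ('e, 'o) event" where
  "fd_input (Rise_Fall l) = Rise l"
| "fd_input (Fall_Rise l) = Fall l"
| "fd_input (Left_Rise_Right_Rise l l') = Rise l"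
| "fd_input (Right_Fall_Left_Rise l l') = Fall l'"

fun fd_output :: "('e, 'o) fd_place \<Rightarrow> ('e, 'o) event" where
  "fd_output (Rise_Fall l) = Fall l"
| "fd_output (Fall_Rise l) = Rise l"
| "fd_output (Left_Rise_Right_Rise l l') = Rise l'"
| "fd_output (Right_Fall_Left_Rise l l') = Rise l"

fun fd_init :: "('e, 'o) fd_place \<Rightarrow> nat" where
  "fd_init (Rise_Fall l) = (if is_odd l then 1 else 0)"
| "fd_init (Fall_Rise l) = (if is_even l then 1 else 0)"
| "fd_init (Left_Rise_Right_Rise l l') = (if is_odd l then 1 else 0)"
| "fd_init (Right_Fall_Left_Rise l l') = 0"

definition FD :: "('e, 'o) circuit \<Rightarrow> (('e, 'o) fd_place, ('e, 'o) event) marked_graph" where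
  "FD c =
     \<lparr>mg_events = Rise ` latches c \<union> Fall ` latches c,
      mg_places =
        Rise_Fall ` latches c \<union> Fall_Rise ` latches c \<union>
        {Left_Rise_Right_Rise l l' | l l'. l' \<in> latches c \<and> l \<in> left_nbrs c l'} \<union>
        {Right_Fall_Left_Rise l l' | l l'. l' \<in> latches c \<and> l \<in> left_nbrs c l'},
      mg_input = fd_input,
      mg_output = fd_output,
      mg_init = fd_init\<rparr>"

lemma left_nbrs_in_latches:
  assumes "is_circuit c" "l' \<in> left_nbrs c l"
  shows "l' \<in> latches c \<and> l \<in> latches c"
  using assms by (cases l) (auto simp: is_circuit_def latches_def left_nbrs_def)

lemma is_marked_graph_FD: "is_circuit c \<Longrightarrow> is_marked_graph (FD c)"
  by (auto simp: is_marked_graph_def FD_def dest: left_nbrs_in_latches)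

end

theory Submission
  imports Defs
begin

text \<open>
  In a run of the fall-decoupled marked graph, a transparent latch has risen exactly as often
  as each even left neighbor, and exactly once more than each odd left neighbor: the places
  \<open>Left_Rise_Right_Rise\<close> give one inequality, and the places \<open>Right_Fall_Left_Rise\<close> together
  with transparency give the other. Hence the left neighbors of a transparent latch hold precisely
  the values that the synchronous recursion consumes. As a latch can only fall while it is
  transparent, the same holds for the value that is captured by a fall.
\<close>

text \<open>Token balance: enabledness makes the truncated subtraction in \<open>fire\<close> exact.
  Self-loops are excluded since \<open>fire\<close> would only remove their token.\<close>

lemma mg_run_marking:
  assumes "mg_run M t m" "p \<in> mg_places M" "mg_input M p \<noteq> mg_output M p"
  shows "m p + num (mg_output M p) t = mg_init M p + num (mg_input M p) t"
  using assms by induction (auto simp: fire_def enabled_def)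

lemma mg_run_ConsE:
  assumes "mg_run M (e # t) m"
  obtains m' where "mg_run M t m'" "enabled M e m'" "m = fire M e m'"
  using assms by (cases rule: mg_run.cases) auto

lemma left_nbrs_parity: "l' \<in> left_nbrs c l \<Longrightarrow> is_even l' \<longleftrightarrow> is_odd l"
  by (cases l) (auto simp: left_nbrs_def)

context
  fixes c :: "('e, 'o) circuit" and t :: "('e, 'o) trace"
    and m :: "('e, 'o) fd_place \<Rightarrow> nat"
  assumes run: "mg_run (FD c) t m"
begin

lemma FD_run_Rise_Fall:
  assumes "l \<in> latches c"
  shows "m (Rise_Fall l) + num (Fall l) t = (if is_odd l then 1 else 0) + num (Rise l) t"
  using mg_run_marking[OF run, of "Rise_Fall l"] assms by (simp add: FD_def)

lemma FD_run_Fall_Rise: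
  assumes "l \<in> latches c"
  shows "m (Fall_Rise l) + num (Rise l) t = (if is_even l then 1 else 0) + num (Fall l) t"
  using mg_run_marking[OF run, of "Fall_Rise l"] assms by (simp add: FD_def)

lemma FD_run_left_rise_right_rise:
  assumes "l \<in> latches c" "l' \<in> left_nbrs c l"
  shows "num (Rise l) t \<le> (if is_odd l' then 1 else 0) + num (Rise l') t"
proof -
  have "l' \<noteq> l"
    using left_nbrs_parity[OF assms(2)] by auto
  then show ?thesis
    using mg_run_marking[OF run, of "Left_Rise_Right_Rise l' l"] assms by (simp add: FD_def)
qed

lemma FD_run_right_fall_left_rise:
  assumes "l \<in> latches c" "l' \<in> left_nbrs c l"
  shows "num (Rise l') t \<le> num (Fall l) t"
  using mg_run_marking[OF run, of "Right_Fall_Left_Rise l' l"] assms by (simp add: FD_def)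

text \<open>\<open>Rise_Fall l\<close> and \<open>Fall_Rise l\<close> hold one token in total, so a
  token in the former fixes the falls of \<open>l\<close> in terms of its rises, and the two
  neighbor inequalities become tight.\<close>

lemma FD_run_nbr_rises:
  assumes "l \<in> latches c" "l' \<in> left_nbrs c l" "m (Rise_Fall l) > 0"
  shows "num (Rise l) t = (if is_odd l' then 1 else 0) + num (Rise l') t"
  using FD_run_Rise_Fall[OF assms(1)] FD_run_Fall_Rise[OF assms(1)] assms(3)
    FD_run_left_rise_right_rise[OF assms(1,2)] FD_run_right_fall_left_rise[OF assms(1,2)]
    left_nbrs_parity[OF assms(2)]
  by (auto split: if_splits)

end

lemma FD_run_transparent:
  assumes "mg_run (FD c) t m" "l \<in> latches c" "transp t l = Transparent"
  shows "m (Rise_Fall l) > 0"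
  using assms by induction (auto simp: FD_def fire_def split: if_splits)

text \<open>The extra 1 counts the initial transparency of an odd latch as a rise.\<close>

definition sync_index :: "('e, 'o) trace \<Rightarrow> ('e, 'o) latch \<Rightarrow> nat" where
  "sync_index t l = (if is_odd l then 1 + num (Rise l) t else num (Rise l) t)"

lemma sync_index_transparent:
  assumes "mg_run (FD c) t m" "l \<in> latches c" "m (Rise_Fall l) > 0"
    and st: "\<forall>l'\<in>left_nbrs c l. st l' = sync c st0 (sync_index t l') l'"
  shows "next_val c st l = sync c st0 (sync_index t l) l"
proof (cases l)
  case (Inl E)
  \<comment> \<open>Index 0 would yield the initial value instead of a next-state value.\<close>
  have "num (Rise l) t > 0"
    using FD_run_Fall_Rise[OF assms(1,2)] FD_run_Rise_Fall[OF assms(1,2)] assms(3) Inl by simp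
  then obtain n where n: "num (Rise l) t = Suc n"
    using gr0_implies_Suc by blast
  \<comment> \<open>Odd neighbors have risen once less, but their index has the extra 1, so it
    equals that of \<open>l\<close>.\<close>
  have "next_val c st l = next_val c (sync c st0 (Suc n)) l"
    using st FD_run_nbr_rises[OF assms(1-2) _ assms(3)] left_nbrs_parity[of _ c l] Inl n
    by (intro next_val_cong) (auto simp: sync_index_def)
  then show ?thesis
    using Inl n by (simp add: sync_index_def)
next
  case (Inr O')
  \<comment> \<open>Even neighbors have risen equally often, so their index is one below that of
    \<open>l\<close>.\<close>
  have "next_val c st l = next_val c (sync c st0 (num (Rise l) t)) l"
    using st FD_run_nbr_rises[OF assms(1-2) _ assms(3)] left_nbrs_parity[of _ c l] Inr
    by (intro next_val_cong) (auto simp: sync_index_def)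
  then show ?thesis
    using Inr by (simp add: sync_index_def)
qed

lemma async_eq_sync:
  assumes "async c st0 t l v" "is_circuit c" "mg_run (FD c) t m" "l \<in> latches c"
  shows "v = sync c st0 (sync_index t l) l"
  using assms
proof (induction arbitrary: m)
  case (async_transparent l t st)
  have "m (Rise_Fall l) > 0"
    using FD_run_transparent async_transparent by blast
  moreover have "\<forall>l'\<in>left_nbrs c l. st l' = sync c st0 (sync_index t l') l'"
    using async_transparent left_nbrs_in_latches by blast
  ultimately show ?case
    using sync_index_transparent async_transparent by blast
next
  case (async_init l)
  then show ?case
    by (cases l) (simp_all add: sync_index_def)
next
  case (async_opaque e t l v)
  obtain m' where "mg_run (FD c) t m'"
    using async_opaque.prems by (auto elim: mg_run_ConsE)
  \<comment> \<open>A rise would make \<open>l\<close> transparent; hence the index of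
    \<open>l\<close> is unchanged.\<close>
  moreover have "e \<noteq> Rise l"
    using async_opaque.hyps by auto
  ultimately show ?case
    using async_opaque by (simp add: sync_index_def)
next
  case (async_fall l t st)
  obtain m' where m': "mg_run (FD c) t m'" "enabled (FD c) (Fall l) m'"
    using async_fall.prems by (auto elim: mg_run_ConsE)
  \<comment> \<open>Enabledness of the fall supplies the token before it fires, and the fall itself
    changes no count of rises.\<close>
  have "m' (Rise_Fall l) > 0"
    using m'(2) async_fall.hyps by (auto simp: enabled_def FD_def)
  moreover have "\<forall>l'\<in>left_nbrs c l. st l' = sync c st0 (sync_index t l') l'"
    using async_fall m'(1) left_nbrs_in_latches by blast
  ultimately have "next_val c st l = sync c st0 (sync_index t l) l"
    using sync_index_transparent m'(1) async_fall.hyps by blast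
  then show ?case
    by (simp add: sync_index_def)
qed

theorem theorem2:
  fixes c :: "('e, 'o) circuit" and st0 :: "('e, 'o) state"
    and t :: "('e, 'o) trace" and m :: "('e, 'o) fd_place \<Rightarrow> nat"
    and l :: "('e, 'o) latch" and v :: val
  assumes "is_circuit c"
    and "mg_run (FD c) t m"
    and "l \<in> latches c"
    and "async c st0 t l v"
  shows "v = sync c st0 (if is_odd l then 1 + num (Rise l) t else num (Rise l) t) l"
  using async_eq_sync[OF assms(4,1,2,3)] by (simp add: sync_index_def)

end
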